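(* Let $\Delta$ be a reciprocal simplicial complex of dimension $d-1$. The following hold: (1) As polynomials in $x$, $$(-1)^d\tilde f(x)=\tilde f^{\mathrm{int}}(-x-1)+m_\emptyset.$$ (2) For every $k$ with $1\le k\le d$, $$f_{k-1}=\sum_{i=k}^d(-1)^{d-i}\binom{i}{k}f^{\mathrm{int}}_{i-1},$$ and, for $k=0$, $$f_{-1}=\sum_{i=1}^d(-1)^{d-i}f^{\mathrm{int}}_{i-1}+(-1)^d m_\emptyset .$$ The last relation is equivalent to $$\chi(\Delta)=(-1)^{d-1}\chi(\Delta^{\mathrm{int}}),\qquad\text{where } \chi(\Delta^{\mathrm{int}}):=\sum_{i=1}^d(-1)^{i-1}f^{\mathrm{int}}_{i-1}.$$
   Context: A simplicial complex $\Delta$ is a finite collection of finite sets (faces), containing the empty face, closed under taking subsets. The dimension of a face $F$ is $|F|-1$, and the dimension $d-1$ of $\Delta$ is the largest dimension of a face. For $0\le i\le d-1$ let $f_i$ be the number of $i$-dimensional faces of $\Delta$, and $f_{-1}=1$ (the empty face). Put $\tilde f(x)=\sum_{i=0}^d f_{i-1}x^i$. The Euler characteristic is $\chi(\Delta)=\sum_{i=1}^d(-1)^{i-1}f_{i-1}$, and the reduced Euler characteristic of a finite simplicial complex $\Gamma$ is $\widetilde\chi(\Gamma)=\sum_{G\in\Gamma}(-1)^{|G|-1}$ (including the empty face). The link of $F\in\Delta$ is $\mathrm{lk}_\Delta F=\{G\in\Delta: G\cap F=\emptyset,\ G\cup F\in\Delta\}$. The multiplicity of a face $F\in\Delta$ is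 $m_F=\sum_{F\subseteq G\in\Delta}(-1)^{d-|G|}=(-1)^{d-1-|F|}\widetilde\chi(\mathrm{lk}_\Delta F)$; in particular $m_\emptyset=(-1)^{d-1}\widetilde\chi(\Delta)$. The complex $\Delta$ is called reciprocal if $m_F\in\{0,1\}$ for every non-empty face $F\in\Delta$. A non-empty face $F$ of a reciprocal complex is called interior if $m_F=1$ and a boundary face if $m_F=0$; the empty face is a boundary face by definition. For $0\le i\le d-1$, $f^{\mathrm{int}}_i$ is the number of $i$-dimensional interior faces, and $\tilde f^{\mathrm{int}}(x)=\sum_{i=1}^d f^{\mathrm{int}}_{i-1}x^i$. *)

theory Defs
  imports "HOL-Computational_Algebra.Polynomial"
begin

definition abstract_simplicial_complex :: "'a set set \<Rightarrow> bool" where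
  "abstract_simplicial_complex \<Delta> \<longleftrightarrow>
     finite \<Delta> \<and> (\<forall>F\<in>\<Delta>. finite F) \<and> {} \<in> \<Delta> \<and> (\<forall>F\<in>\<Delta>. \<forall>G. G \<subseteq> F \<longrightarrow> G \<in> \<Delta>)"

text \<open>Dimensions are integers, since the empty face has dimension \<open>-1\<close>.\<close>

definition face_dim :: "'a set \<Rightarrow> int" where
  "face_dim F = int (card F) - 1"

definition complex_dim :: "'a set set \<Rightarrow> int" where
  "complex_dim \<Delta> = Max (face_dim ` \<Delta>)"

text \<open>The number \<open>d\<close> for which the complex has dimension \<open>d - 1\<close>; it is \<open>0\<close> for
  the complex whose only face is the empty one.\<close>

definition complex_d :: "'a set set \<Rightarrow> nat" where
  "complex_d \<Delta> = nat (complex_dim \<Delta> + 1)"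

definition f_num :: "'a set set \<Rightarrow> int \<Rightarrow> nat" where
  "f_num \<Delta> j = card {F \<in> \<Delta>. face_dim F = j}"

definition f_poly :: "'a set set \<Rightarrow> int poly" where
  "f_poly \<Delta> = (\<Sum>i=0..complex_d \<Delta>. monom (int (f_num \<Delta> (int i - 1))) i)"

definition euler_char :: "'a set set \<Rightarrow> int" where
  "euler_char \<Delta> = (\<Sum>i=1..complex_d \<Delta>. (-1) ^ (i - 1) * int (f_num \<Delta> (int i - 1)))"

text \<open>The exponent \<open>card G + 1\<close> stands for \<open>card G - 1\<close>, which is negative for the
  empty face.\<close>

definition reduced_euler_char :: "'a set set \<Rightarrow> int" where
  "reduced_euler_char \<Gamma> = (\<Sum>G\<in>\<Gamma>. (-1) ^ (card G + 1))"

definition link :: "'a set set \<Rightarrow> 'a set \<Rightarrow> 'a set set" where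
  "link \<Delta> F = {G \<in> \<Delta>. G \<inter> F = {} \<and> G \<union> F \<in> \<Delta>}"

text \<open>The natural-number subtraction does not truncate: \<open>card G \<le> complex_d \<Delta>\<close> for every
  face \<open>G\<close> of a complex \<open>\<Delta>\<close>, see \<open>card_le_complex_d\<close> below.\<close>

definition multiplicity_face :: "'a set set \<Rightarrow> 'a set \<Rightarrow> int" where
  "multiplicity_face \<Delta> F = (\<Sum>G\<in>{G \<in> \<Delta>. F \<subseteq> G}. (-1) ^ (complex_d \<Delta> - card G))"

definition reciprocal_complex :: "'a set set \<Rightarrow> bool" where
  "reciprocal_complex \<Delta> \<longleftrightarrow>
     abstract_simplicial_complex \<Delta> \<and>
     (\<forall>F\<in>\<Delta>. F \<noteq> {} \<longrightarrow> multiplicity_face \<Delta> F \<in> {0, 1})"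

text \<open>The empty face is never interior, whatever its multiplicity.\<close>

definition interior_face :: "'a set set \<Rightarrow> 'a set \<Rightarrow> bool" where
  "interior_face \<Delta> F \<longleftrightarrow> F \<in> \<Delta> \<and> F \<noteq> {} \<and> multiplicity_face \<Delta> F = 1"

definition f_int_num :: "'a set set \<Rightarrow> int \<Rightarrow> nat" where
  "f_int_num \<Delta> j = card {F. interior_face \<Delta> F \<and> face_dim F = j}"

definition f_int_poly :: "'a set set \<Rightarrow> int poly" where
  "f_int_poly \<Delta> = (\<Sum>i=1..complex_d \<Delta>. monom (int (f_int_num \<Delta> (int i - 1))) i)"

definition euler_char_int :: "'a set set \<Rightarrow> int" where
  "euler_char_int \<Delta> =
     (\<Sum>i=1..complex_d \<Delta>. (-1) ^ (i - 1) * int (f_int_num \<Delta> (int i - 1)))"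

lemma card_le_complex_d:
  assumes "abstract_simplicial_complex \<Delta>" "G \<in> \<Delta>"
  shows "card G \<le> complex_d \<Delta>"
proof -
  have "face_dim G \<le> complex_dim \<Delta>"
    using assms by (simp add: complex_dim_def abstract_simplicial_complex_def)
  then show ?thesis
    by (simp add: complex_d_def face_dim_def)
qed

text \<open>The sign \<open>(-1)^(d - 1 - card F)\<close> is written with exponent \<open>d + 1 - card F\<close>, which is
  never negative.\<close>

lemma multiplicity_face_link:
  assumes \<Delta>: "abstract_simplicial_complex \<Delta>" and F: "F \<in> \<Delta>"
  shows "multiplicity_face \<Delta> F =
    (-1) ^ (complex_d \<Delta> + 1 - card F) * reduced_euler_char (link \<Delta> F)"
proof -
  have fin: "finite G" if "G \<in> \<Delta>" for G
    using \<Delta> that by (auto simp: abstract_simplicial_complex_def)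
  have down: "H \<in> \<Delta>" if "G \<in> \<Delta>" "H \<subseteq> G" for G H
    using \<Delta> that by (auto simp: abstract_simplicial_complex_def)
  have bij: "bij_betw (\<lambda>G. G \<union> F) (link \<Delta> F) {G \<in> \<Delta>. F \<subseteq> G}"
    by (rule bij_betw_byWitness[where f' = "\<lambda>G. G - F"])
      (auto simp: link_def Un_absorb2 intro: down)
  have "multiplicity_face \<Delta> F =
      (\<Sum>G\<in>link \<Delta> F. (-1) ^ (complex_d \<Delta> - card (G \<union> F)))"
    unfolding multiplicity_face_def by (rule sum.reindex_bij_betw[OF bij, symmetric])
  also have "\<dots> = (\<Sum>G\<in>link \<Delta> F. (-1) ^ (complex_d \<Delta> + 1 - card F) * (-1) ^ (card G + 1))"
  proof (rule sum.cong[OF refl])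
    fix G assume G: "G \<in> link \<Delta> F"
    then have c: "card (G \<union> F) = card G + card F"
      using fin F by (auto simp: link_def intro: card_Un_disjoint)
    have "card (G \<union> F) \<le> complex_d \<Delta>"
      using G card_le_complex_d[OF \<Delta>] by (auto simp: link_def)
    then have e: "complex_d \<Delta> + 1 - card F + (card G + 1)
        = (complex_d \<Delta> - card (G \<union> F)) + 2 * (card G + 1)"
      using c by arith
    have "(-1 :: int) ^ (complex_d \<Delta> + 1 - card F) * (-1) ^ (card G + 1)
        = (-1) ^ ((complex_d \<Delta> - card (G \<union> F)) + 2 * (card G + 1))"
      by (simp only: power_add[symmetric] e)
    also have "\<dots> = (-1) ^ (complex_d \<Delta> - card (G \<union> F))"
      by (simp only: power_add power_mult power2_minus one_power2 power_one mult_1_right)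
    finally show "(-1) ^ (complex_d \<Delta> - card (G \<union> F))
        = (-1) ^ (complex_d \<Delta> + 1 - card F) * (-1 :: int) ^ (card G + 1)"
      by (rule sym)
  qed
  finally show ?thesis
    by (simp add: reduced_euler_char_def sum_distrib_left)
qed

end

theory Submission
  imports Defs
begin

text \<open>
  Both relations come from one double count over pairs of nested faces. Since the
  subsets of a face \<open>G\<close> are all faces, \<open>\<Sum>F\<subseteq>G. y ^ card F = (1 + y) ^ card G\<close>, and
  therefore, for \<open>y\<close> in any commutative ring,
  \<open>\<Sum>F. m\<^sub>F * y ^ card F = \<Sum>G. (-1) ^ (d - card G) * (1 + y) ^ card G\<close>
  (\<open>sum_multiplicity_face\<close>). At \<open>y = -x-1\<close> the base on the right is \<open>-x\<close>, whose signs
  cancel the \<open>(-1) ^ (d - card G)\<close> up to \<open>(-1) ^ d\<close>: the right-hand side is \<open>(-1) ^ d\<close>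
  times the \<open>f\<close>-polynomial. In a reciprocal complex the multiplicity is the indicator
  of the interior on non-empty faces, so the left-hand side is the interior
  \<open>f\<close>-polynomial at \<open>-x-1\<close>, plus the term \<open>m\<close> of the empty face.

  The relations between face numbers are this identity read coefficient by coefficient.
  The last equivalence holds because \<open>(-1) ^ d * m\<close> for the empty face is the
  alternating count of all faces, that is \<open>1 - \<chi>(\<Delta>)\<close>.
\<close>

lemma sum_Pow_power_card:
  fixes y :: "'b :: comm_ring_1"
  assumes "finite G"
  shows "(\<Sum>F\<in>Pow G. y ^ card F) = (1 + y) ^ card G"
  using prod_add[OF assms, of "\<lambda>_. y" "\<lambda>_. 1"] by (simp add: add.commute)

lemma neg_one_power_diff:
  assumes "k \<le> n"
  shows "(-1 :: 'b :: ring_1) ^ (n - k) = (-1) ^ n * (-1) ^ k"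
  using assms by (simp add: minus_one_power_iff)

text \<open>The double count. The inner sum of a multiplicity runs over the faces above \<open>F\<close>;
  exchanging it with the sum over \<open>F\<close> leaves the subsets of a fixed face.\<close>

lemma sum_multiplicity_face:
  fixes y :: "'b :: comm_ring_1"
  assumes \<Delta>: "abstract_simplicial_complex \<Delta>"
  shows "(\<Sum>F\<in>\<Delta>. of_int (multiplicity_face \<Delta> F) * y ^ card F)
    = (\<Sum>G\<in>\<Delta>. (-1) ^ (complex_d \<Delta> - card G) * (1 + y) ^ card G)"
proof -
  have fin: "finite \<Delta>" and finF: "\<And>F. F \<in> \<Delta> \<Longrightarrow> finite F"
    using \<Delta> by (auto simp: abstract_simplicial_complex_def)
  have Pow: "{F \<in> \<Delta>. F \<subseteq> G} = Pow G" if "G \<in> \<Delta>" for G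
    using \<Delta> that by (auto simp: abstract_simplicial_complex_def)
  have "(\<Sum>F\<in>\<Delta>. of_int (multiplicity_face \<Delta> F) * y ^ card F)
      = (\<Sum>F\<in>\<Delta>. \<Sum>G\<in>{G \<in> \<Delta>. F \<subseteq> G}. (-1) ^ (complex_d \<Delta> - card G) * y ^ card F)"
    by (simp add: multiplicity_face_def sum_distrib_right)
  also have "\<dots> = (\<Sum>G\<in>\<Delta>. \<Sum>F\<in>{F \<in> \<Delta>. F \<subseteq> G}. (-1) ^ (complex_d \<Delta> - card G) * y ^ card F)"
    by (rule sum.swap_restrict[OF fin fin])
  also have "\<dots> = (\<Sum>G\<in>\<Delta>. (-1) ^ (complex_d \<Delta> - card G) * (1 + y) ^ card G)"
    by (intro sum.cong refl)
      (simp add: Pow finF sum_Pow_power_card flip: sum_distrib_left)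
  finally show ?thesis .
qed

text \<open>Turns the sums over face numbers that define polynomials and Euler characteristics
  into sums over faces. The index set \<open>I\<close> is \<open>{0..d}\<close> for all faces and \<open>{1..d}\<close> for
  the non-empty or the interior ones.\<close>

lemma sum_face_numbers:
  fixes g :: "nat \<Rightarrow> 'b :: comm_ring_1"
  assumes "finite A" "finite I" "card ` A \<subseteq> I"
  shows "(\<Sum>i\<in>I. of_nat (card {F \<in> A. face_dim F = int i - 1}) * g i) = (\<Sum>F\<in>A. g (card F))"
proof -
  have "(\<Sum>F\<in>A. g (card F)) = (\<Sum>i\<in>I. \<Sum>F\<in>{F \<in> A. card F = i}. g (card F))"
    by (rule sum.group[OF assms, symmetric])
  also have "\<dots> = (\<Sum>i\<in>I. of_nat (card {F \<in> A. face_dim F = int i - 1}) * g i)"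
    by (intro sum.cong refl) (simp add: face_dim_def)
  finally show ?thesis by (rule sym)
qed

lemma pcompose_monom_power:
  fixes q :: "'b :: comm_ring_1 poly"
  shows "pcompose (monom c n) q = smult c (q ^ n)"
  by (simp add: pcompose_altdef map_poly_monom poly_monom)

lemma f_poly_eq_sum_faces:
  assumes \<Delta>: "abstract_simplicial_complex \<Delta>"
  shows "f_poly \<Delta> = (\<Sum>F\<in>\<Delta>. monom 1 (card F))"
proof -
  have "finite \<Delta>" "card ` \<Delta> \<subseteq> {0..complex_d \<Delta>}"
    using \<Delta> card_le_complex_d[OF \<Delta>] by (auto simp: abstract_simplicial_complex_def)
  then show ?thesis
    using sum_face_numbers[of \<Delta> "{0..complex_d \<Delta>}" "monom (1 :: int)"]
    by (simp add: f_poly_def f_num_def of_nat_poly smult_monom)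
qed

lemma pcompose_f_int_poly:
  assumes \<Delta>: "abstract_simplicial_complex \<Delta>"
  shows "pcompose (f_int_poly \<Delta>) q = (\<Sum>F\<in>{F. interior_face \<Delta> F}. q ^ card F)"
proof -
  have "{F. interior_face \<Delta> F} \<subseteq> \<Delta>"
    by (auto simp: interior_face_def)
  then have "finite {F. interior_face \<Delta> F}"
    using \<Delta> finite_subset by (auto simp: abstract_simplicial_complex_def)
  moreover have "card ` {F. interior_face \<Delta> F} \<subseteq> {1..complex_d \<Delta>}"
    using \<Delta> card_le_complex_d[OF \<Delta>]
    by (auto simp: interior_face_def abstract_simplicial_complex_def Suc_le_eq card_gt_0_iff)
  ultimately show ?thesis
    using sum_face_numbers[of "{F. interior_face \<Delta> F}" "{1..complex_d \<Delta>}" "\<lambda>i. q ^ i"]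
    by (simp add: f_int_poly_def f_int_num_def pcompose_sum pcompose_monom_power of_nat_poly)
qed

text \<open>Being reciprocal is what allows the weight \<open>m\<^sub>F\<close> to be replaced by membership in the
  interior. The empty face has to be split off, as its multiplicity is unrestricted.\<close>

lemma sum_multiplicity_face_reciprocal:
  fixes y :: "'b :: comm_ring_1"
  assumes "reciprocal_complex \<Delta>"
  shows "(\<Sum>F\<in>\<Delta>. of_int (multiplicity_face \<Delta> F) * y ^ card F)
    = (\<Sum>F\<in>{F. interior_face \<Delta> F}. y ^ card F) + of_int (multiplicity_face \<Delta> {})"
proof -
  have fin: "finite \<Delta>" and empty: "{} \<in> \<Delta>"
    and m: "\<forall>F\<in>\<Delta>. F \<noteq> {} \<longrightarrow> multiplicity_face \<Delta> F = 0 \<or> multiplicity_face \<Delta> F = 1"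
    using assms by (auto simp: reciprocal_complex_def abstract_simplicial_complex_def)
  have "(\<Sum>F\<in>{F. interior_face \<Delta> F}. y ^ card F)
      = (\<Sum>F\<in>\<Delta> - {{}}. of_int (multiplicity_face \<Delta> F) * y ^ card F)"
    using fin m by (intro sum.mono_neutral_cong_left) (auto simp: interior_face_def)
  then show ?thesis
    by (simp add: sum.remove[OF fin empty] add.commute)
qed

theorem f_poly_reciprocity:
  assumes rec: "reciprocal_complex \<Delta>"
  shows "smult ((-1) ^ complex_d \<Delta>) (f_poly \<Delta>)
    = pcompose (f_int_poly \<Delta>) [:-1, -1:] + [:multiplicity_face \<Delta> {}:]"
proof -
  have \<Delta>: "abstract_simplicial_complex \<Delta>"
    using rec by (simp add: reciprocal_complex_def)
  have "pcompose (f_int_poly \<Delta>) [:-1, -1:] + [:multiplicity_face \<Delta> {}:]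
      = (\<Sum>F\<in>\<Delta>. of_int (multiplicity_face \<Delta> F) * [:-1, -1:] ^ card F)"
    unfolding sum_multiplicity_face_reciprocal[OF rec] pcompose_f_int_poly[OF \<Delta>]
    by (simp only: of_int_poly of_int_eq_id id_apply)
  also have "\<dots> = (\<Sum>G\<in>\<Delta>. (-1) ^ (complex_d \<Delta> - card G) * (1 + [:-1, -1:]) ^ card G)"
    by (rule sum_multiplicity_face[OF \<Delta>])
  also have "\<dots> = (\<Sum>G\<in>\<Delta>. (-1) ^ complex_d \<Delta> * monom 1 (card G))"
  proof (intro sum.cong refl)
    fix G assume "G \<in> \<Delta>"
    then have le: "card G \<le> complex_d \<Delta>" by (rule card_le_complex_d[OF \<Delta>])
    have "1 + [:-1, -1:] = (-1 :: int poly) * monom 1 1"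
      by (simp add: monom_altdef one_pCons)
    then have "(1 + [:-1, -1:] :: int poly) ^ card G = (-1) ^ card G * monom 1 (card G)"
      by (simp only: power_mult_distrib monom_power) simp
    then have "(-1) ^ (complex_d \<Delta> - card G) * (1 + [:-1, -1:] :: int poly) ^ card G
        = (-1) ^ complex_d \<Delta> * ((-1) ^ card G * (-1) ^ card G) * monom 1 (card G)"
      by (simp only: neg_one_power_diff[OF le] mult.assoc)
    then show "(-1) ^ (complex_d \<Delta> - card G) * (1 + [:-1, -1:] :: int poly) ^ card G
        = (-1) ^ complex_d \<Delta> * monom 1 (card G)"
      by (simp flip: power_mult_distrib)
  qed
  also have "\<dots> = smult ((-1) ^ complex_d \<Delta>) (f_poly \<Delta>)"
    by (simp add: f_poly_eq_sum_faces[OF \<Delta>] minus_one_power_iff sum_negf)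
  finally show ?thesis by (rule sym)
qed

lemma coeff_neg_one_minus_x_power:
  "coeff ([:-1, -1:] ^ i :: int poly) k = (-1) ^ i * int (i choose k)"
proof (cases "k \<le> i")
  case True
  then show ?thesis
    by (simp add: coeff_linear_poly_power mult.assoc flip: power_add)
next
  case False
  then show ?thesis
    by (simp add: coeff_eq_0 binomial_eq_0)
qed

text \<open>Coefficient \<open>k\<close> of the reciprocity. The coefficient of a constant polynomial covers
  \<open>k = 0\<close>, where the multiplicity of the empty face enters, together with \<open>k > 0\<close>.\<close>

lemma f_num_eq_sum_f_int_num:
  assumes rec: "reciprocal_complex \<Delta>" and d: "d = complex_d \<Delta>" and "k \<le> d"
  shows "int (f_num \<Delta> (int k - 1))
    = (\<Sum>i=1..d. (-1) ^ (d - i) * int (i choose k) * int (f_int_num \<Delta> (int i - 1)))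
      + (-1) ^ d * coeff [:multiplicity_face \<Delta> {}:] k"
proof -
  have "(-1) ^ d * int (f_num \<Delta> (int k - 1)) = coeff (smult ((-1) ^ d) (f_poly \<Delta>)) k"
    using \<open>k \<le> d\<close> by (simp add: f_poly_def coeff_sum d)
  also have "\<dots> = (\<Sum>i=1..d. int (f_int_num \<Delta> (int i - 1)) * ((-1) ^ i * int (i choose k)))
      + coeff [:multiplicity_face \<Delta> {}:] k"
    unfolding d f_poly_reciprocity[OF rec]
    by (simp add: f_int_poly_def coeff_sum pcompose_sum pcompose_monom_power
        coeff_neg_one_minus_x_power)
  finally have "(-1) ^ d * ((-1) ^ d * int (f_num \<Delta> (int k - 1)))
      = (\<Sum>i=1..d. (-1) ^ d * (int (f_int_num \<Delta> (int i - 1)) * ((-1) ^ i * int (i choose k))))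
        + (-1) ^ d * coeff [:multiplicity_face \<Delta> {}:] k"
    by (simp only: distrib_left sum_distrib_left)
  moreover have "(-1) ^ d * ((-1) ^ d * int (f_num \<Delta> (int k - 1))) = int (f_num \<Delta> (int k - 1))"
    by (simp add: minus_one_power_iff)
  moreover have "(\<Sum>i=1..d. (-1) ^ d * (int (f_int_num \<Delta> (int i - 1)) * ((-1) ^ i * int (i choose k))))
      = (\<Sum>i=1..d. (-1) ^ (d - i) * int (i choose k) * int (f_int_num \<Delta> (int i - 1)))"
    by (intro sum.cong refl) (simp add: neg_one_power_diff)
  ultimately show ?thesis by simp
qed

text \<open>The multiplicity of the empty face is, up to sign, the reduced Euler characteristic;
  the summand \<open>1\<close> is the contribution of the empty face itself.\<close>

lemma multiplicity_face_empty:
  assumes \<Delta>: "abstract_simplicial_complex \<Delta>"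
  shows "(-1) ^ complex_d \<Delta> * multiplicity_face \<Delta> {} = 1 - euler_char \<Delta>"
proof -
  have fin: "finite \<Delta>" and empty: "{} \<in> \<Delta>" and finF: "\<And>F. F \<in> \<Delta> \<Longrightarrow> finite F"
    using \<Delta> by (auto simp: abstract_simplicial_complex_def)
  have *: "card ` (\<Delta> - {{}}) \<subseteq> {1..complex_d \<Delta>}"
    using finF card_le_complex_d[OF \<Delta>] by (auto simp: Suc_le_eq card_gt_0_iff)
  have "(\<Sum>F\<in>\<Delta> - {{}}. (-1 :: int) ^ card F)
      = (\<Sum>i=1..complex_d \<Delta>. int (card {F \<in> \<Delta> - {{}}. face_dim F = int i - 1}) * (-1) ^ i)"
    using sum_face_numbers[OF _ _ *, of "\<lambda>i. (-1 :: int) ^ i"] fin by simp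
  also have "\<dots> = (\<Sum>i=1..complex_d \<Delta>. - ((-1) ^ (i - 1) * int (f_num \<Delta> (int i - 1))))"
  proof (intro sum.cong refl)
    fix i assume i: "i \<in> {1..complex_d \<Delta>}"
    then have "{F \<in> \<Delta> - {{}}. face_dim F = int i - 1} = {F \<in> \<Delta>. face_dim F = int i - 1}"
      by (auto simp: face_dim_def)
    moreover have "(-1 :: int) ^ i = - ((-1) ^ (i - 1))"
      using i by (cases i) auto
    ultimately show "int (card {F \<in> \<Delta> - {{}}. face_dim F = int i - 1}) * (-1) ^ i
        = - ((-1) ^ (i - 1) * int (f_num \<Delta> (int i - 1)))"
      by (simp add: f_num_def)
  qed
  also have "\<dots> = - euler_char \<Delta>"
    by (simp add: euler_char_def sum_negf)
  finally have "(\<Sum>F\<in>\<Delta>. (-1 :: int) ^ card F) = 1 - euler_char \<Delta>"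
    by (simp add: sum.remove[OF fin empty])
  moreover have "(-1) ^ complex_d \<Delta> * multiplicity_face \<Delta> {} = (\<Sum>F\<in>\<Delta>. (-1) ^ card F)"
    unfolding multiplicity_face_def sum_distrib_left
    by (intro sum.cong)
      (auto simp: neg_one_power_diff[OF card_le_complex_d[OF \<Delta>]]
        simp flip: mult.assoc power_mult_distrib)
  ultimately show ?thesis by simp
qed

lemma sum_f_int_num_eq_euler_char_int:
  assumes "d = complex_d \<Delta>"
  shows "(\<Sum>i=1..d. (-1) ^ (d - i) * int (f_int_num \<Delta> (int i - 1)))
    = (-1) ^ (d + 1) * euler_char_int \<Delta>"
  unfolding euler_char_int_def assms[symmetric] sum_distrib_left
proof (intro sum.cong refl)
  fix i assume i: "i \<in> {1..d}"
  have "d + 1 + (i - 1) = (d - i) + 2 * i"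
    using i by auto
  then have "(-1 :: int) ^ (d + 1) * (-1) ^ (i - 1) = (-1) ^ (d - i) * (-1) ^ (2 * i)"
    by (simp only: power_add[symmetric])
  then show "(-1) ^ (d - i) * int (f_int_num \<Delta> (int i - 1))
      = (-1) ^ (d + 1) * ((-1) ^ (i - 1) * int (f_int_num \<Delta> (int i - 1)))"
    by (simp flip: mult.assoc)
qed

theorem theorem4p2:
  fixes \<Delta> :: "'a set set" and d :: nat
  assumes "reciprocal_complex \<Delta>"
    and "complex_dim \<Delta> = int d - 1"
  shows
    "smult ((-1) ^ d) (f_poly \<Delta>)
       = pcompose (f_int_poly \<Delta>) [:-1, -1:] + [:multiplicity_face \<Delta> {}:]
     \<and> (\<forall>k. 1 \<le> k \<and> k \<le> d \<longrightarrow>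
          int (f_num \<Delta> (int k - 1))
            = (\<Sum>i=k..d. (-1) ^ (d - i) * int (i choose k) * int (f_int_num \<Delta> (int i - 1))))
     \<and> int (f_num \<Delta> (-1))
            = (\<Sum>i=1..d. (-1) ^ (d - i) * int (f_int_num \<Delta> (int i - 1)))
              + (-1) ^ d * multiplicity_face \<Delta> {}
     \<and> (int (f_num \<Delta> (-1))
            = (\<Sum>i=1..d. (-1) ^ (d - i) * int (f_int_num \<Delta> (int i - 1)))
              + (-1) ^ d * multiplicity_face \<Delta> {}
        \<longleftrightarrow> euler_char \<Delta> = (-1) ^ (d + 1) * euler_char_int \<Delta>)"
proof -
  have \<Delta>: "abstract_simplicial_complex \<Delta>"
    using assms(1) by (simp add: reciprocal_complex_def)
  have d: "d = complex_d \<Delta>"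
    using assms(2) by (simp add: complex_d_def)
  have positive: "int (f_num \<Delta> (int k - 1))
      = (\<Sum>i=k..d. (-1) ^ (d - i) * int (i choose k) * int (f_int_num \<Delta> (int i - 1)))"
    if k: "1 \<le> k" "k \<le> d" for k
  proof -
    have "int (f_num \<Delta> (int k - 1))
        = (\<Sum>i=1..d. (-1) ^ (d - i) * int (i choose k) * int (f_int_num \<Delta> (int i - 1)))"
      using k f_num_eq_sum_f_int_num[OF assms(1) d k(2)] by (simp add: coeff_pCons split: nat.split)
    also have "\<dots> = (\<Sum>i=k..d. (-1) ^ (d - i) * int (i choose k) * int (f_int_num \<Delta> (int i - 1)))"
      using k by (intro sum.mono_neutral_right) (auto simp: binomial_eq_0)
    finally show ?thesis .
  qed
  have zero: "int (f_num \<Delta> (-1)) = (\<Sum>i=1..d. (-1) ^ (d - i) * int (f_int_num \<Delta> (int i - 1)))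
      + (-1) ^ d * multiplicity_face \<Delta> {}"
    using f_num_eq_sum_f_int_num[OF assms(1) d, of 0] by simp
  have "{F \<in> \<Delta>. face_dim F = -1} = {{}}"
    using \<Delta> by (auto simp: face_dim_def abstract_simplicial_complex_def)
  then have "f_num \<Delta> (-1) = 1"
    by (simp add: f_num_def)
  moreover have "(-1) ^ d * multiplicity_face \<Delta> {} = 1 - euler_char \<Delta>"
    using multiplicity_face_empty[OF \<Delta>] by (simp add: d)
  (* Both \<open>1\<close>s count the empty face and cancel. *)
  ultimately have "int (f_num \<Delta> (-1))
        = (\<Sum>i=1..d. (-1) ^ (d - i) * int (f_int_num \<Delta> (int i - 1)))
          + (-1) ^ d * multiplicity_face \<Delta> {}
      \<longleftrightarrow> euler_char \<Delta> = (-1) ^ (d + 1) * euler_char_int \<Delta>"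
    unfolding sum_f_int_num_eq_euler_char_int[OF d] by linarith
  then show ?thesis
    using f_poly_reciprocity[OF assms(1)] positive zero by (simp only: d) blast
qed

end
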